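(* For all non-negative integers $m,n$, the super FiboCatalan number $$S(m,n)_F=\frac{F_{2m}!\,F_{2n}!}{F_m!\,F_n!\,F_{m+n}!}$$ is a positive integer; and for all non-negative integers $r,n$, the generalized FiboCatalan number $$J_{r,F}\,\frac{F_{2n}!}{F_n!\,F_{n+r+1}!},\qquad\text{where } J_{r,F}=\frac{F_{2r+1}!}{F_r!},$$ is a positive integer.
   Context: $F_n$ denotes the Fibonacci numbers: $F_0=0$, $F_1=1$, $F_n=F_{n-1}+F_{n-2}$ for $n\ge 2$. The notation $F_n!$ means the product of Fibonacci numbers $F_nF_{n-1}\cdots F_2F_1$ for $n\ge 1$ (not the factorial of the integer $F_n$), and $F_0!=1$ (empty product). *)

theory Defs
  imports "HOL-Number_Theory.Fib"
begin

definition fib_fact :: "nat \<Rightarrow> nat" where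
  "fib_fact n = (\<Prod>i=1..n. fib i)"

text \<open>The quotients below are taken in the rationals, so that no truncating division is
  involved and integrality is a genuine claim.\<close>

definition super_fibocatalan :: "nat \<Rightarrow> nat \<Rightarrow> rat" where
  "super_fibocatalan m n =
     of_nat (fib_fact (2 * m) * fib_fact (2 * n)) /
     of_nat (fib_fact m * fib_fact n * fib_fact (m + n))"

definition fib_J :: "nat \<Rightarrow> rat" where
  "fib_J r = of_nat (fib_fact (2 * r + 1)) / of_nat (fib_fact r)"

definition gen_fibocatalan :: "nat \<Rightarrow> nat \<Rightarrow> rat" where
  "gen_fibocatalan r n =
     fib_J r * (of_nat (fib_fact (2 * n)) / of_nat (fib_fact n * fib_fact (n + r + 1)))"

end

theory Submission
  imports Defs "HOL-Computational_Algebra.Primes"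
begin

text \<open>The indices $i$ with $q \mid F_i$ are the multiples of a single number $d$, since
  $\gcd(F_m, F_n) = F_{\gcd(m, n)}$. Hence, as in Legendre's formula, the multiplicity of a prime $p$
  in $F_1 \cdots F_n$ is a sum of terms $\lfloor n / d_k \rfloor$, where $d_k$ belongs to $q = p^k$,
  and both divisibilities reduce to inequalities between such floors.\<close>

lemma dvd_fib_iff_dvd_index: "\<exists>d. \<forall>i. q dvd fib i \<longleftrightarrow> d dvd i"
proof (cases "\<exists>i>0. q dvd fib i")
  case True
  define d where "d = (LEAST i. i > 0 \<and> q dvd fib i)"
  from True have d: "d > 0" "q dvd fib d"
    unfolding d_def by (metis (mono_tags, lifting) LeastI_ex)+
  have "d dvd i" if "q dvd fib i" for i
  proof -
    \<comment> \<open>\<open>gcd d i\<close> is again a positive index, so the minimality of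
      \<open>d\<close> forces \<open>gcd d i = d\<close>.\<close>
    have "q dvd fib (gcd d i)" using d that by (simp add: fib_gcd)
    then have "d \<le> gcd d i" unfolding d_def
      by (intro Least_le) (use d in \<open>auto simp: d_def\<close>)
    then show ?thesis
      by (metis d(1) dvd_imp_le gcd_dvd1 gcd_dvd2 le_antisym)
  qed
  moreover have "q dvd fib i" if "d dvd i" for i
    using that d(2) by (metis dvd_trans fib_gcd gcd_dvd2 gcd_nat.absorb1)
  ultimately show ?thesis by blast
next
  case False
  \<comment> \<open>\<open>d = 0\<close>, in accordance with \<open>n div 0 = 0\<close> below\<close>
  then have "\<forall>i. q dvd fib i \<longleftrightarrow> 0 dvd i" by (metis dvd_0_left_iff dvd_0_right fib0 gr0I)
  then show ?thesis by blast
qed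

lemma sum_of_bool_dvd: "(\<Sum>i=1..n. of_bool (d dvd i)) = n div (d::nat)"
  by (induction n) (auto simp: div_Suc dvd_eq_mod_eq_0)

text \<open>The summands beyond the multiplicity vanish, so any upper bound \<open>K\<close> will
  do. One range can then serve many \<open>x\<close>, which is what allows sums to be exchanged
  later.\<close>

lemma multiplicity_eq_sum_of_bool:
  fixes p x :: nat
  assumes "prime p" "x > 0" "multiplicity p x \<le> K"
  shows "multiplicity p x = (\<Sum>k=1..K. of_bool (p ^ k dvd x))"
proof -
  have "p ^ k dvd x \<longleftrightarrow> k \<le> multiplicity p x" for k
    using assms by (intro power_dvd_iff_le_multiplicity) auto
  moreover have "{1..K} \<inter> {k. k \<le> multiplicity p x} = {1..multiplicity p x}"
    using assms(3) by auto
  ultimately show ?thesis by (simp add: sum.If_cases of_bool_def)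
qed

lemma fib_fact_pos: "fib_fact n > 0"
  by (auto simp: fib_fact_def intro!: prod_pos fib_neq_0_nat)

text \<open>Bounding the arguments by \<open>N\<close> lets one \<open>K\<close> serve all of them,
  so that the sums for different \<open>n\<close> can be compared term by term.\<close>

lemma multiplicity_fib_fact:
  fixes p :: nat
  assumes "prime p"
  obtains d :: "nat \<Rightarrow> nat" and K :: nat where
    "\<And>n. n \<le> N \<Longrightarrow> multiplicity p (fib_fact n) = (\<Sum>k=1..K. n div d k)"
proof -
  obtain d where d: "\<And>k i. p ^ k dvd fib i \<longleftrightarrow> d k dvd i"
    using choice[of "\<lambda>k d. \<forall>i. p ^ k dvd fib i \<longleftrightarrow> d dvd i"] dvd_fib_iff_dvd_index by blast
  \<comment> \<open>A crude common bound: a sum of naturals dominates each summand.\<close>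
  define K where "K = (\<Sum>i\<le>N. multiplicity p (fib i))"
  have "multiplicity p (fib_fact n) = (\<Sum>k=1..K. n div d k)" if "n \<le> N" for n
  proof -
    have "multiplicity p (fib_fact n) = (\<Sum>i=1..n. multiplicity p (fib i))"
      unfolding fib_fact_def using assms
      by (intro prime_elem_multiplicity_prod_distrib) (auto simp: image_iff Suc_le_eq dest: fib_neq_0_nat)
    also have "\<dots> = (\<Sum>i=1..n. \<Sum>k=1..K. of_bool (p ^ k dvd fib i))"
    proof (intro sum.cong refl multiplicity_eq_sum_of_bool assms)
      fix i assume i: "i \<in> {1..n}"
      then show "fib i > 0" by (simp add: fib_neq_0_nat)
      show "multiplicity p (fib i) \<le> K"
        unfolding K_def using i that by (intro member_le_sum) auto
    qed
    \<comment> \<open>Exchanging the sums counts, for each \<open>k\<close>, the multiples of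
      \<open>d k\<close> up to \<open>n\<close>.\<close>
    also have "\<dots> = (\<Sum>k=1..K. \<Sum>i=1..n. of_bool (d k dvd i))"
      by (subst sum.swap) (simp only: d)
    finally show ?thesis by (simp only: sum_of_bool_dvd)
  qed
  then show thesis by (rule that)
qed

text \<open>For each prime, both multiplicities are sums over the same \<open>k\<close>, and
  \<open>le\<close> at the divisor \<open>d k\<close> settles the \<open>k\<close>-th term.\<close>

lemma fib_fact_dvd:
  assumes le: "\<And>d. a div d + b div d + c div d \<le> e div d + f div d"
  shows "fib_fact a * fib_fact b * fib_fact c dvd fib_fact e * fib_fact f"
proof (rule multiplicity_le_imp_dvd)
  fix p :: nat assume p: "prime p"
  \<comment> \<open>The sum serves only as a bound above all five arguments.\<close>
  obtain d :: "nat \<Rightarrow> nat" and K where d: "\<And>n. n \<le> a + b + c + e + f \<Longrightarrow>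
      multiplicity p (fib_fact n) = (\<Sum>k=1..K. n div d k)"
    by (rule multiplicity_fib_fact[OF p]) blast
  have "(\<Sum>k=1..K. a div d k + b div d k + c div d k) \<le> (\<Sum>k=1..K. e div d k + f div d k)"
    by (intro sum_mono le)
  then show "multiplicity p (fib_fact a * fib_fact b * fib_fact c)
      \<le> multiplicity p (fib_fact e * fib_fact f)"
    using p fib_fact_pos
    by (simp add: prime_elem_multiplicity_mult_distrib d sum.distrib less_imp_neq[symmetric])
qed (simp add: fib_fact_pos less_imp_neq[symmetric])

text \<open>Both sides contain the quotients of \<open>m\<close> and \<open>n\<close> twice each, so
  only the remainders matter. The super FiboCatalan numbers need \<open>e = 0\<close>, the
  generalized ones \<open>e = 1\<close>.\<close>

lemma div_add_le_div_double:
  fixes d :: nat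
  assumes "e \<le> 1"
  shows "m div d + n div d + (m + n + e) div d \<le> (2 * m + e) div d + 2 * n div d"
proof (cases "d = 0")
  case False
  define a b s t where "a = m div d" "b = n div d" "s = m mod d" "t = n mod d"
  have mn: "m = a * d + s" "n = b * d + t"
    by (auto simp: a_b_s_t_def)
  have *: "(k * d + x) div d = k + x div d" for k x
    using False by simp
  have "m + n + e = (a + b) * d + (s + t + e)" "2 * m + e = (2 * a) * d + (2 * s + e)"
    "2 * n = (2 * b) * d + 2 * t"
    by (simp_all add: mn algebra_simps)
  moreover have "(s + t + e) div d \<le> (2 * s + e) div d + 2 * t div d"
  \<comment> \<open>The term with the larger remainder alone dominates the left side.\<close>
  proof (cases "t \<le> s")
    case True
    then have "(s + t + e) div d \<le> (2 * s + e) div d" by (intro div_le_mono) simp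
    then show ?thesis by simp
  next
    case False
    \<comment> \<open>Here \<open>s + 1 \<le> t\<close>, which absorbs \<open>e\<close>.\<close>
    then have "(s + t + e) div d \<le> 2 * t div d" using assms by (intro div_le_mono) simp
    then show ?thesis by simp
  qed
  ultimately show ?thesis by (simp only: * flip: a_b_s_t_def)
qed simp

lemma of_nat_divide_in_Ints_pos:
  assumes "b dvd a" "a > (0::nat)"
  shows "of_nat a / of_nat b \<in> (\<int> :: rat set) \<and> of_nat a / of_nat b > (0 :: rat)"
proof -
  from assms obtain c where "a = b * c" "b > 0" "c > 0" by (auto elim!: dvdE)
  then show ?thesis by simp
qed

theorem corollary1:
  shows "(\<forall>m n :: nat. super_fibocatalan m n \<in> \<int> \<and> super_fibocatalan m n > 0) \<and>
         (\<forall>r n :: nat. gen_fibocatalan r n \<in> \<int> \<and> gen_fibocatalan r n > 0)"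
\<comment> \<open>This instance of \<open>conjI\<close> splits only the outer conjunction, keeping
  integrality and positivity together.\<close>
proof (intro conjI[of "\<forall>m n. _ m n"] allI)
  fix m n :: nat
  show "super_fibocatalan m n \<in> \<int> \<and> super_fibocatalan m n > 0"
    unfolding super_fibocatalan_def
    by (intro of_nat_divide_in_Ints_pos fib_fact_dvd)
       (use div_add_le_div_double[of 0] in \<open>simp_all add: fib_fact_pos\<close>)
next
  fix r n :: nat
  \<comment> \<open>The odd index \<open>2 * r + 1\<close> in \<open>fib_J\<close> calls for
    \<open>e = 1\<close>.\<close>
  have "r div d + n div d + (n + r + 1) div d \<le> (2 * r + 1) div d + 2 * n div d" for d
    using div_add_le_div_double[of 1 r d n] by (simp only: add.commute[of n r])
  note dvd = fib_fact_dvd[OF this]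
  have "gen_fibocatalan r n = of_nat (fib_fact (2 * r + 1) * fib_fact (2 * n)) /
      of_nat (fib_fact r * fib_fact n * fib_fact (n + r + 1))"
    by (simp add: gen_fibocatalan_def fib_J_def)
  also have "\<dots> \<in> \<int> \<and> \<dots> > 0"
    by (intro of_nat_divide_in_Ints_pos dvd) (simp add: fib_fact_pos)
  finally show "gen_fibocatalan r n \<in> \<int> \<and> gen_fibocatalan r n > 0" .
qed

end
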